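(* Let $n\ge0$ be an integer, $\varrho>-1$, $\Upsilon$ a positive integer, $\mu\in\mathbb{C}$ with $\mathrm{Re}(\mu)\ge0$, $w\in\mathbb{C}$, $B\in\mathbb{R}$. For $Y>B$, $${}_{Y}D^{\mu}_{B^+}\left[(Y-B)^{\varrho}\,{}_{\Upsilon}H_n^{\varrho}(X,w(Y-B))\right]=(Y-B)^{\varrho-\mu}\,{}_{\Upsilon}H_n^{\varrho-\mu}(X,w(Y-B)).$$
   Context: $(a)_k$ is the Pochhammer symbol and $[\cdot]$ the integer part. The 2D Hermite–Konhauser polynomials are $${}_{\Upsilon}H_n^{\varrho}(X,Y)=\sum_{s=0}^{[n/2]}\sum_{r=0}^{n-s}\frac{(-1)^s(-n)_{2s}(-n)_{s+r}}{(-n)_s\,\Gamma(\varrho+1+\Upsilon r)\,s!\,r!}(2X)^{n-2s}Y^{\Upsilon r}$$ (the same formula, with $1/\Gamma$ the entire function, is used for arbitrary complex upper parameter). The Riemann–Liouville fractional derivative is ${}_{Y}D^{\mu}_{B^+}f=\left(\frac{d}{dY}\right)^k{}_{Y}I^{k-\mu}_{B^+}f$ with $k=[\mathrm{Re}(\mu)]+1$ and ${}_{Y}I^{\lambda}_{B^+}(f)(Y)=\frac{1}{\Gamma(\lambda)}\int_B^Y(Y-t)^{\lambda-1}f(t)\,dt$. *)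

theory Defs
  imports "HOL-Analysis.Analysis"
begin

text \<open>The entire function \<^const>\<open>rGamma\<close> is the reciprocal Gamma function, so the definition makes
  sense for every complex upper parameter. For \<open>s \<le> n div 2\<close> the divisor
  \<open>pochhammer (- of_nat n) s\<close> is nonzero.\<close>

definition hermite_konhauser :: "nat \<Rightarrow> complex \<Rightarrow> nat \<Rightarrow> complex \<Rightarrow> complex \<Rightarrow> complex" where
  "hermite_konhauser \<upsilon> \<rho> n X Y =
     (\<Sum>s=0..n div 2. \<Sum>r=0..n - s.
        (-1) ^ s * pochhammer (- of_nat n) (2 * s) * pochhammer (- of_nat n) (s + r)
        / (pochhammer (- of_nat n) s * fact s * fact r)
        * rGamma (\<rho> + 1 + of_nat (\<upsilon> * r))
        * (2 * X) ^ (n - 2 * s) * Y ^ (\<upsilon> * r))"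

definition rl_integrand :: "complex \<Rightarrow> (real \<Rightarrow> complex) \<Rightarrow> real \<Rightarrow> real \<Rightarrow> complex" where
  "rl_integrand \<nu> f y t = complex_of_real (y - t) powr (\<nu> - 1) * f t"

definition rl_integral :: "complex \<Rightarrow> real \<Rightarrow> (real \<Rightarrow> complex) \<Rightarrow> real \<Rightarrow> complex" where
  "rl_integral \<nu> B f y = 1 / Gamma \<nu> * (LBINT t:{B..y}. rl_integrand \<nu> f y t)"

definition iterated_deriv :: "nat \<Rightarrow> (real \<Rightarrow> complex) \<Rightarrow> real \<Rightarrow> complex" where
  "iterated_deriv k = (\<lambda>g y. vector_derivative g (at y)) ^^ k"

definition rl_order :: "complex \<Rightarrow> nat" where
  "rl_order \<mu> = nat \<lfloor>Re \<mu>\<rfloor> + 1"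

definition rl_derivative :: "complex \<Rightarrow> real \<Rightarrow> (real \<Rightarrow> complex) \<Rightarrow> real \<Rightarrow> complex" where
  "rl_derivative \<mu> B f =
     iterated_deriv (rl_order \<mu>) (rl_integral (of_nat (rl_order \<mu>) - \<mu>) B f)"

text \<open>Integrals and derivatives are total functions here; the following predicate says that the
  integral and all the derivatives occurring in \<^const>\<open>rl_derivative\<close> really exist to the right
  of \<open>B\<close>.\<close>

definition rl_differentiable :: "complex \<Rightarrow> real \<Rightarrow> (real \<Rightarrow> complex) \<Rightarrow> bool" where
  "rl_differentiable \<mu> B f \<longleftrightarrow>
     (\<forall>y>B. set_integrable lborel {B..y} (rl_integrand (of_nat (rl_order \<mu>) - \<mu>) f y)) \<and>
     (\<forall>j<rl_order \<mu>. \<forall>y>B.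
        iterated_deriv j (rl_integral (of_nat (rl_order \<mu>) - \<mu>) B f) differentiable (at y))"

end

theory Submission
  imports Defs
begin

text \<open>
  Up to constants independent of \<open>\<rho>\<close>, the function to be differentiated is a finite sum of terms
  \<open>(y - B) powr \<sigma> / Gamma (\<sigma> + 1)\<close> with \<open>\<sigma> = \<rho> + \<upsilon> r\<close>. On such a term the fractional integral of
  order \<open>\<nu>\<close> acts as the shift \<open>\<sigma> \<mapsto> \<sigma> + \<nu>\<close>, by the Beta integral, and the ordinary derivative as
  \<open>\<sigma> \<mapsto> \<sigma> - 1\<close>, so the fractional derivative of order \<open>\<mu>\<close> replaces \<open>\<rho>\<close> by \<open>\<rho> - \<mu>\<close>. The Beta
  integral for complex exponents is obtained by integrating the convolution of two Gamma integrands.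
\<close>

section \<open>Powers extended by zero and convolution\<close>

text \<open>Extending powers by zero to the negative axis makes the fractional integral of a power a
  convolution over the whole line. Since \<open>0 powr z = 0\<close>, the endpoints need no separate treatment.\<close>

definition pos_powr :: "complex \<Rightarrow> real \<Rightarrow> complex" where
  "pos_powr z t = (if t > 0 then of_real t powr z else 0)"

lemma borel_measurable_pos_powr [measurable]: "pos_powr z \<in> borel_measurable borel"
proof -
  have "pos_powr z = (\<lambda>t. if t > 0 then exp (z * of_real (ln t)) else 0)"
    by (auto simp: pos_powr_def powr_def Ln_of_real)
  thus ?thesis by simp
qed

lemma pos_powr_mult: "c > 0 \<Longrightarrow> pos_powr z (c * t) = of_real c powr z * pos_powr z t"
  by (auto simp: pos_powr_def zero_less_mult_iff powr_times_real)

lemma norm_pos_powr: "norm (pos_powr z t) = (if t > 0 then t powr Re z else 0)"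
  by (simp add: pos_powr_def norm_powr_real_powr)

text \<open>Fubini applies because integrating the norm first in \<open>u\<close> leaves
  \<open>norm (f t)\<close> times a constant: Lebesgue measure is invariant under translation by
  \<open>t\<close>.\<close>

lemma integral_convolution:
  fixes f g :: "real \<Rightarrow> complex"
  assumes f: "integrable lborel f" and g: "integrable lborel g"
  shows "(LBINT u. LBINT t. f t * g (u - t)) = (LBINT t. f t) * (LBINT u. g u)"
proof -
  have [measurable]: "f \<in> borel_measurable borel" "g \<in> borel_measurable borel"
    using borel_measurable_integrable[OF f] borel_measurable_integrable[OF g] by simp_all
  have shift: "integrable lborel (\<lambda>u. g (u - t))" "(LBINT u. g (u - t)) = (LBINT u. g u)"
    "(LBINT u. norm (g (u - t))) = (LBINT u. norm (g u))" for t
    using lborel_integrable_real_affine[OF g, of 1 "- t"]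
      lborel_integral_real_affine[of 1 g "- t"] lborel_integral_real_affine[of 1 "\<lambda>u. norm (g u)" "- t"]
    by simp_all
  have "integrable (lborel \<Otimes>\<^sub>M lborel) (\<lambda>(t, u). f t * g (u - t))"
    by (rule lborel_pair.Fubini_integrable) (use f in \<open>auto simp: norm_mult shift\<close>)
  from lborel_pair.Fubini_integral[OF this]
  have "(LBINT u. LBINT t. f t * g (u - t)) = (LBINT t. LBINT u. f t * g (u - t))" .
  thus ?thesis by (simp add: shift)
qed

section \<open>Complex Gamma and Beta integrals\<close>

lemma Gamma_neq_zero_Re: "Gamma z \<noteq> 0" if "Re z > 0" for z :: complex
  using that by (auto simp: Gamma_eq_zero_iff elim!: nonpos_Ints_cases)

text \<open>Euler's integral on the half-line, moved from the gauge integral and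
  \<open>lebesgue\<close> to \<open>lborel\<close> on the whole line, the form that
  \<open>integral_convolution\<close> takes.\<close>

lemma Gamma_pos_powr:
  assumes "Re z > 0"
  shows "integrable lborel (\<lambda>t. pos_powr (z - 1) t * of_real (exp (- t)))"
    and "(LBINT t. pos_powr (z - 1) t * of_real (exp (- t))) = Gamma z"
proof -
  let ?h = "\<lambda>t. pos_powr (z - 1) t * of_real (exp (- t))"
  let ?f = "\<lambda>t. complex_of_real t powr (z - 1) / of_real (exp t)"
  have eq: "(\<lambda>t. indicator {0<..} t *\<^sub>R ?f t) = ?h"
    by (auto simp: pos_powr_def indicator_def exp_minus field_simps)
  have abs: "?f absolutely_integrable_on {0<..}"
    using assms by (rule absolutely_integrable_Gamma_integral')
  have m: "?h \<in> borel_measurable lborel" by measurable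
  show "integrable lborel ?h"
    using abs integrable_completion[OF m] unfolding set_integrable_def eq by simp
  have "(LBINT t. ?h t) = (LINT t|lebesgue. ?h t)"
    using integral_completion[OF m] by simp
  also have "\<dots> = (LINT t:{0<..}|lebesgue. ?f t)"
    by (simp add: set_lebesgue_integral_def eq)
  also have "\<dots> = integral {0<..} ?f"
    by (rule set_lebesgue_integral_eq_integral(2)[OF abs])
  also have "\<dots> = Gamma z"
    by (rule integral_unique[OF Gamma_integral_complex'[OF assms]])
  finally show "(LBINT t. ?h t) = Gamma z" .
qed

text \<open>Substitute \<open>u * t\<close> for \<open>t\<close>: homogeneity of the two powers
  contributes the exponent \<open>a + b\<close>, and the Jacobian contributes the extra 1.\<close>

lemma pos_powr_convolution_scale:
  assumes "u > 0"
  shows "integrable lborel (\<lambda>t. pos_powr a t * pos_powr b (1 - t)) \<Longrightarrow>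
           integrable lborel (\<lambda>t. pos_powr a t * pos_powr b (u - t))"
    and "(LBINT t. pos_powr a t * pos_powr b (u - t)) =
           of_real u powr (a + b + 1) * (LBINT t. pos_powr a t * pos_powr b (1 - t))"
proof -
  let ?h = "\<lambda>t. pos_powr a t * pos_powr b (u - t)"
  have scale: "?h (u * t) = of_real u powr (a + b) * (pos_powr a t * pos_powr b (1 - t))" for t
  proof -
    have "u - u * t = u * (1 - t)" by (simp add: algebra_simps)
    thus ?thesis using assms by (simp add: pos_powr_mult powr_add)
  qed
  show "integrable lborel ?h" if "integrable lborel (\<lambda>t. pos_powr a t * pos_powr b (1 - t))"
    using lborel_integrable_real_affine_iff[of u ?h 0] assms that by (simp add: scale)
  show "(LBINT t. ?h t) = of_real u powr (a + b + 1) * (LBINT t. pos_powr a t * pos_powr b (1 - t))"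
    using lborel_integral_real_affine[of u ?h 0] assms
    by (simp add: scale powr_add scaleR_conv_of_real)
qed

text \<open>The norm of a complex power of a positive real depends only on the real part of the
  exponent, so the real Beta integrand dominates.\<close>

lemma integrable_pos_powr_Beta:
  assumes "Re a > 0" "Re b > 0"
  shows "integrable lborel (\<lambda>t. pos_powr (a - 1) t * pos_powr (b - 1) (1 - t))"
proof (rule Bochner_Integration.integrable_bound)
  show "integrable lborel (\<lambda>t. indicator {0..1} t *\<^sub>R (t powr (Re a - 1) * (1 - t) powr (Re b - 1)))"
    using integrable_Beta[of "Re a" "Re b"] assms unfolding set_integrable_def by simp
  show "AE t in lborel. norm (pos_powr (a - 1) t * pos_powr (b - 1) (1 - t)) \<le>
      norm (indicator {0..1} t *\<^sub>R (t powr (Re a - 1) * (1 - t) powr (Re b - 1)))"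
    by (rule AE_I2) (simp add: norm_mult norm_pos_powr)
qed measurable

lemma pos_powr_Beta:
  assumes a: "Re a > 0" and b: "Re b > 0"
  shows "(LBINT t. pos_powr (a - 1) t * pos_powr (b - 1) (1 - t)) = Beta a b"
proof -
  let ?J = "LBINT t. pos_powr (a - 1) t * pos_powr (b - 1) (1 - t)"
  \<comment> \<open>The exponentials combine to \<open>exp (- u)\<close>, free of \<open>t\<close>,
    and scaling to the unit interval leaves \<open>?J\<close> times the Gamma integrand of
    \<open>a + b\<close>. For \<open>u\<close> at most 0 both sides vanish.\<close>
  have inner: "(LBINT t. (pos_powr (a - 1) t * of_real (exp (- t))) *
      (pos_powr (b - 1) (u - t) * of_real (exp (- (u - t))))) =
      ?J * (pos_powr (a + b - 1) u * of_real (exp (- u)))" for u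
  proof -
    have "(\<lambda>t. (pos_powr (a - 1) t * of_real (exp (- t))) *
              (pos_powr (b - 1) (u - t) * of_real (exp (- (u - t))))) =
          (\<lambda>t. of_real (exp (- u)) * (pos_powr (a - 1) t * pos_powr (b - 1) (u - t)))"
    proof
      fix t
      have "complex_of_real (exp (- u)) = of_real (exp (- t)) * of_real (exp (- (u - t)))"
        by (simp flip: of_real_mult exp_add)
      thus "(pos_powr (a - 1) t * of_real (exp (- t))) *
              (pos_powr (b - 1) (u - t) * of_real (exp (- (u - t)))) =
            of_real (exp (- u)) * (pos_powr (a - 1) t * pos_powr (b - 1) (u - t))"
        by simp
    qed
    moreover have "(LBINT t. pos_powr (a - 1) t * pos_powr (b - 1) (u - t)) =
        ?J * pos_powr (a + b - 1) u"
    proof (cases "u > 0")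
      case True
      thus ?thesis
        unfolding pos_powr_convolution_scale(2)[OF True] pos_powr_def[of "a + b - 1"]
        by (simp add: algebra_simps)
    next
      case False
      hence "(\<lambda>t. pos_powr (a - 1) t * pos_powr (b - 1) (u - t)) = (\<lambda>_. 0)"
        by (auto simp: pos_powr_def)
      with False show ?thesis by (simp add: pos_powr_def)
    qed
    ultimately show ?thesis by simp
  qed
  have "Gamma a * Gamma b = ?J * Gamma (a + b)"
    using integral_convolution[OF Gamma_pos_powr(1)[OF a] Gamma_pos_powr(1)[OF b]]
      Gamma_pos_powr(2)[of "a + b"] a b
    unfolding inner by (simp add: Gamma_pos_powr(2))
  moreover have "Gamma (a + b) \<noteq> 0"
    using a b by (intro Gamma_neq_zero_Re) simp
  ultimately show ?thesis by (simp add: Beta_def)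
qed


section \<open>Fractional integrals of sums of powers\<close>

text \<open>With the factor \<open>rGamma\<close>, integration and differentiation change only
  \<kappa>, the accumulated order of integration (negative for derivatives); \<open>c\<close> and
  \<sigma> stay fixed.\<close>

definition frac_power_sum ::
  "('i \<Rightarrow> complex) \<Rightarrow> ('i \<Rightarrow> complex) \<Rightarrow> 'i set \<Rightarrow> real \<Rightarrow> complex \<Rightarrow> real \<Rightarrow> complex" where
  "frac_power_sum c \<sigma> P B \<kappa> y =
     (\<Sum>p\<in>P. c p * (rGamma (\<sigma> p + \<kappa> + 1) * pos_powr (\<sigma> p + \<kappa>) (y - B)))"

text \<open>One power vanishes left of \<open>B\<close> and the other right of \<open>y\<close>, so
  together they absorb the indicator.\<close>

lemma indicator_rl_integrand:
  assumes "\<And>t. t \<ge> B \<Longrightarrow> f t = (\<Sum>p\<in>P. c p * pos_powr (\<sigma> p) (t - B))"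
  shows "indicator {B..y} t *\<^sub>R rl_integrand \<nu> f y t =
           (\<Sum>p\<in>P. c p * (pos_powr (\<sigma> p) (t - B) * pos_powr (\<nu> - 1) (y - t)))"
proof -
  have "indicator {B..y} t *\<^sub>R rl_integrand \<nu> f y t =
          pos_powr (\<nu> - 1) (y - t) * (\<Sum>p\<in>P. c p * pos_powr (\<sigma> p) (t - B))"
    by (auto simp: rl_integrand_def assms indicator_def pos_powr_def)
  thus ?thesis by (simp add: sum_distrib_left mult_ac)
qed

lemma pos_powr_convolution_shift:
  assumes \<nu>: "Re \<nu> > 0" and \<sigma>: "Re \<sigma> > -1" and y: "y > B"
  shows "integrable lborel (\<lambda>t. pos_powr \<sigma> (t - B) * pos_powr (\<nu> - 1) (y - t))"
    and "(LBINT t. pos_powr \<sigma> (t - B) * pos_powr (\<nu> - 1) (y - t)) =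
           Beta (\<sigma> + 1) \<nu> * pos_powr (\<sigma> + \<nu>) (y - B)"
proof -
  let ?h = "\<lambda>t. pos_powr \<sigma> t * pos_powr (\<nu> - 1) (y - B - t)"
  have "integrable lborel ?h"
    using integrable_pos_powr_Beta[of "\<sigma> + 1" \<nu>] pos_powr_convolution_scale(1)[of "y - B" \<sigma> "\<nu> - 1"]
      assms by simp
  from lborel_integrable_real_affine[OF this, of 1 "- B"]
  show "integrable lborel (\<lambda>t. pos_powr \<sigma> (t - B) * pos_powr (\<nu> - 1) (y - t))" by simp
  have "(LBINT t. ?h t) = Beta (\<sigma> + 1) \<nu> * pos_powr (\<sigma> + \<nu>) (y - B)"
    using pos_powr_Beta[of "\<sigma> + 1" \<nu>] pos_powr_convolution_scale(2)[of "y - B" \<sigma> "\<nu> - 1"] assms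
    by (simp add: pos_powr_def[of "\<sigma> + \<nu>"])
  with lborel_integral_real_affine[of 1 ?h "- B"]
  show "(LBINT t. pos_powr \<sigma> (t - B) * pos_powr (\<nu> - 1) (y - t)) =
           Beta (\<sigma> + 1) \<nu> * pos_powr (\<sigma> + \<nu>) (y - B)" by simp
qed

lemma rl_integral_frac_power_sum:
  assumes \<nu>: "Re \<nu> > 0" and \<sigma>: "\<And>p. p \<in> P \<Longrightarrow> Re (\<sigma> p) > -1" and y: "y > B"
    and f: "\<And>t. t \<ge> B \<Longrightarrow> f t = frac_power_sum c \<sigma> P B 0 t"
  shows "set_integrable lborel {B..y} (rl_integrand \<nu> f y)"
    and "rl_integral \<nu> B f y = frac_power_sum c \<sigma> P B \<nu> y"
proof -
  have eq: "(\<lambda>t. indicator {B..y} t *\<^sub>R rl_integrand \<nu> f y t) =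
      (\<lambda>t. \<Sum>p\<in>P. c p * rGamma (\<sigma> p + 1) * (pos_powr (\<sigma> p) (t - B) * pos_powr (\<nu> - 1) (y - t)))"
    by (rule ext, rule indicator_rl_integrand) (simp add: f frac_power_sum_def mult_ac)
  have int: "integrable lborel (\<lambda>t. pos_powr (\<sigma> p) (t - B) * pos_powr (\<nu> - 1) (y - t))"
    if "p \<in> P" for p
    using pos_powr_convolution_shift(1) \<nu> \<sigma> y that by blast
  show "set_integrable lborel {B..y} (rl_integrand \<nu> f y)"
    unfolding set_integrable_def eq by (intro Bochner_Integration.integrable_sum integrable_mult_right int)
  have Gam: "Gamma \<nu> \<noteq> 0" "\<And>p. p \<in> P \<Longrightarrow> Gamma (\<sigma> p + 1) \<noteq> 0"
    using \<nu> by (rule Gamma_neq_zero_Re) (rule Gamma_neq_zero_Re, use \<sigma> in force)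
  have "(LBINT t:{B..y}. rl_integrand \<nu> f y t) =
      (\<Sum>p\<in>P. c p * rGamma (\<sigma> p + 1) * (Beta (\<sigma> p + 1) \<nu> * pos_powr (\<sigma> p + \<nu>) (y - B)))"
    unfolding set_lebesgue_integral_def eq
    by (subst Bochner_Integration.integral_sum)
       (auto intro!: integrable_mult_right int sum.cong simp: pos_powr_convolution_shift(2) \<nu> \<sigma> y)
  \<comment> \<open>\<open>Beta (\<sigma> p + 1) \<nu>\<close> is \<open>Gamma (\<sigma> p + 1) *
    Gamma \<nu> * rGamma (\<sigma> p + \<nu> + 1)\<close>. Its first factor cancels the old
    normalization, the last is the new one, and \<open>Gamma \<nu>\<close> cancels the prefactor of
    \<open>rl_integral\<close>.\<close>
  also have "\<dots> = Gamma \<nu> * frac_power_sum c \<sigma> P B \<nu> y"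
    unfolding frac_power_sum_def sum_distrib_left
    by (intro sum.cong) (use Gam in \<open>auto simp: Beta_altdef rGamma_inverse_Gamma add_ac\<close>)
  finally show "rl_integral \<nu> B f y = frac_power_sum c \<sigma> P B \<nu> y"
    using Gam by (simp add: rl_integral_def)
qed

section \<open>Ordinary and fractional derivatives of sums of powers\<close>

lemma has_vector_derivative_pos_powr:
  assumes "y > B"
  shows "((\<lambda>y. pos_powr \<sigma> (y - B)) has_vector_derivative \<sigma> * pos_powr (\<sigma> - 1) (y - B)) (at y)"
proof -
  have "((\<lambda>y. complex_of_real (y - B)) has_vector_derivative 1) (at y)"
    by (auto intro!: derivative_eq_intros)
  moreover have "((\<lambda>z. z powr \<sigma>) has_field_derivative \<sigma> * complex_of_real (y - B) powr (\<sigma> - 1))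
      (at (complex_of_real (y - B)))"
    by (rule has_field_derivative_powr) (use assms in \<open>auto simp del: of_real_diff\<close>)
  ultimately have "((\<lambda>z. z powr \<sigma>) \<circ> (\<lambda>y. complex_of_real (y - B)) has_vector_derivative
      1 * (\<sigma> * complex_of_real (y - B) powr (\<sigma> - 1))) (at y)"
    by (rule field_vector_diff_chain_at)
  hence "((\<lambda>y. complex_of_real (y - B) powr \<sigma>) has_vector_derivative
      \<sigma> * pos_powr (\<sigma> - 1) (y - B)) (at y)"
    using assms by (simp add: o_def pos_powr_def)
  thus ?thesis
    by (rule has_vector_derivative_transform_within_open[of _ _ _ "{B<..}"])
       (use assms in \<open>auto simp: pos_powr_def\<close>)
qed

lemma has_vector_derivative_frac_power_sum:
  assumes "y > B"
  shows "(frac_power_sum c \<sigma> P B \<kappa> has_vector_derivative frac_power_sum c \<sigma> P B (\<kappa> - 1) y) (at y)"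
proof -
  have "(frac_power_sum c \<sigma> P B \<kappa> has_vector_derivative
      (\<Sum>p\<in>P. c p * (rGamma (\<sigma> p + \<kappa> + 1) * ((\<sigma> p + \<kappa>) * pos_powr (\<sigma> p + \<kappa> - 1) (y - B))))) (at y)"
    unfolding frac_power_sum_def[abs_def]
    by (intro has_vector_derivative_sum has_vector_derivative_mult_right
          has_vector_derivative_pos_powr assms)
  also have "(\<Sum>p\<in>P. c p * (rGamma (\<sigma> p + \<kappa> + 1) * ((\<sigma> p + \<kappa>) * pos_powr (\<sigma> p + \<kappa> - 1) (y - B)))) =
      frac_power_sum c \<sigma> P B (\<kappa> - 1) y"
    unfolding frac_power_sum_def
  proof (intro sum.cong refl)
    fix p
    show "c p * (rGamma (\<sigma> p + \<kappa> + 1) * ((\<sigma> p + \<kappa>) * pos_powr (\<sigma> p + \<kappa> - 1) (y - B))) =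
        c p * (rGamma (\<sigma> p + (\<kappa> - 1) + 1) * pos_powr (\<sigma> p + (\<kappa> - 1)) (y - B))"
      \<comment> \<open>The recurrence \<open>z * rGamma (z + 1) = rGamma z\<close> also holds at
        the poles of Gamma, so a power whose derivative vanishes needs no separate case.\<close>
      using rGamma_plus1[of "\<sigma> p + \<kappa>"] by (simp add: add_diff_eq mult_ac)
  qed
  finally show ?thesis .
qed

text \<open>Equality on the open half-line right of \<open>B\<close> suffices to transfer
  derivatives there, and each derivative is again such a sum with \<kappa> lowered by one, which
  drives the induction.\<close>

lemma has_vector_derivative_iterated_deriv:
  assumes g: "\<And>y. y > B \<Longrightarrow> g y = frac_power_sum c \<sigma> P B \<nu> y" and y: "y > B"
  shows "(iterated_deriv j g has_vector_derivative frac_power_sum c \<sigma> P B (\<nu> - of_nat (Suc j)) y) (at y)"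
    and "iterated_deriv j g y = frac_power_sum c \<sigma> P B (\<nu> - of_nat j) y"
proof -
  have step: "(h has_vector_derivative frac_power_sum c \<sigma> P B (\<kappa> - 1) y) (at y)"
    if "\<And>y. y > B \<Longrightarrow> h y = frac_power_sum c \<sigma> P B \<kappa> y" "y > B" for h \<kappa> y
    using has_vector_derivative_frac_power_sum[OF that(2)]
    by (rule has_vector_derivative_transform_within_open[of _ _ _ "{B<..}"]) (use that in auto)
  have val: "iterated_deriv j g y = frac_power_sum c \<sigma> P B (\<nu> - of_nat j) y" if "y > B" for j y
    using that
  proof (induction j arbitrary: y)
    case 0
    thus ?case by (simp add: iterated_deriv_def g)
  next
    case (Suc j)
    from step[OF Suc.IH Suc.prems] show ?case
      by (simp add: iterated_deriv_def vector_derivative_at algebra_simps)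
  qed
  show "iterated_deriv j g y = frac_power_sum c \<sigma> P B (\<nu> - of_nat j) y" using val y .
  from step[OF val y]
  show "(iterated_deriv j g has_vector_derivative frac_power_sum c \<sigma> P B (\<nu> - of_nat (Suc j)) y) (at y)"
    by (simp add: algebra_simps)
qed

lemma rl_derivative_frac_power_sum:
  assumes "Re \<mu> \<ge> 0" and \<sigma>: "\<And>p. p \<in> P \<Longrightarrow> Re (\<sigma> p) > -1"
    and f: "\<And>t. t \<ge> B \<Longrightarrow> f t = frac_power_sum c \<sigma> P B 0 t"
  shows "rl_differentiable \<mu> B f"
    and "y > B \<Longrightarrow> rl_derivative \<mu> B f y = frac_power_sum c \<sigma> P B (- \<mu>) y"
proof -
  define \<nu> where "\<nu> = of_nat (rl_order \<mu>) - \<mu>"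
  \<comment> \<open>The floor plus one strictly exceeds \<open>Re \<mu>\<close>, and the floor is
    nonnegative, so \<open>nat\<close> does not truncate it.\<close>
  have \<nu>: "Re \<nu> > 0"
    using assms(1) by (simp add: \<nu>_def rl_order_def) linarith
  note I = rl_integral_frac_power_sum[OF \<nu> \<sigma> _ f]
  show "rl_differentiable \<mu> B f"
    unfolding rl_differentiable_def \<nu>_def[symmetric]
    using I(1) has_vector_derivative_iterated_deriv(1)[OF I(2)]
    by (blast intro: differentiableI_vector)
  show "rl_derivative \<mu> B f y = frac_power_sum c \<sigma> P B (- \<mu>) y" if "y > B"
    using has_vector_derivative_iterated_deriv(2)[OF I(2) that]
    by (simp add: rl_derivative_def \<nu>_def)
qed

section \<open>Application to the Hermite-Konhauser polynomials\<close>

text \<open>The prefactor merges with the powers of \<open>y - B\<close>, and the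
  \<open>rGamma\<close> of the polynomial is exactly the normalization. One identity thus serves
  twice: \<kappa> = 0 gives the function to differentiate, \<kappa> = -\<mu> the result.\<close>

lemma hermite_konhauser_conv_frac_power_sum:
  assumes "y \<ge> B"
  shows "complex_of_real (y - B) powr (\<rho> + \<kappa>)
           * hermite_konhauser \<upsilon> (\<rho> + \<kappa>) n X (w * complex_of_real (y - B)) =
         frac_power_sum
           (\<lambda>(s, r). (-1) ^ s * pochhammer (- of_nat n) (2 * s) * pochhammer (- of_nat n) (s + r)
              / (pochhammer (- of_nat n) s * fact s * fact r) * (2 * X) ^ (n - 2 * s) * w ^ (\<upsilon> * r))
           (\<lambda>(s, r). \<rho> + of_nat (\<upsilon> * r)) (SIGMA s:{0..n div 2}. {0..n - s}) B \<kappa> y"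
proof -
  \<comment> \<open>At \<open>y = B\<close> both sides are 0 for every exponent, since
    \<open>0 powr z = 0\<close>; elsewhere this is addition of exponents.\<close>
  have pow: "complex_of_real (y - B) powr (\<rho> + \<kappa>) * complex_of_real (y - B) ^ m =
      pos_powr (\<rho> + of_nat m + \<kappa>) (y - B)" for m
  proof (cases "y = B")
    case False
    hence "complex_of_real (y - B) \<noteq> 0" by simp
    hence "complex_of_real (y - B) ^ m = complex_of_real (y - B) powr of_nat m"
      by (rule powr_complexpow[symmetric])
    with False assms show ?thesis
      by (simp add: pos_powr_def add_ac flip: powr_add del: powr_complexpow)
  qed (simp add: pos_powr_def)
  have Gam: "\<rho> + \<kappa> + 1 + of_nat m = \<rho> + of_nat m + \<kappa> + 1" for m
    by simp
  have rearrange: "complex_of_real (y - B) powr (\<rho> + \<kappa>)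
        * (C * R * A * (w * complex_of_real (y - B)) ^ m) =
      C * A * w ^ m * (R * pos_powr (\<rho> + of_nat m + \<kappa>) (y - B))" for C R A m
    unfolding pow[symmetric] power_mult_distrib by (simp only: mult_ac)
  show ?thesis
    unfolding frac_power_sum_def hermite_konhauser_def sum_distrib_left
    by (subst sum.Sigma, rule finite_atLeastAtMost, simp, rule sum.cong[OF refl], clarify,
        unfold prod.case Gam, rule rearrange)
qed

theorem corollary6:
  fixes n \<upsilon> :: nat and \<rho> B Y :: real and \<mu> w X :: complex
  assumes "\<rho> > -1" and "\<upsilon> > 0" and "Re \<mu> \<ge> 0" and "Y > B"
  defines "f \<equiv> (\<lambda>y. complex_of_real (y - B) powr complex_of_real \<rho>
                    * hermite_konhauser \<upsilon> (complex_of_real \<rho>) n X (w * complex_of_real (y - B)))"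
  shows "rl_differentiable \<mu> B f \<and>
         rl_derivative \<mu> B f Y =
           complex_of_real (Y - B) powr (complex_of_real \<rho> - \<mu>)
           * hermite_konhauser \<upsilon> (complex_of_real \<rho> - \<mu>) n X (w * complex_of_real (Y - B))"
proof -
  define P where "P = (SIGMA s:{0..n div 2}. {0..n - s})"
  define \<sigma> :: "nat \<times> nat \<Rightarrow> complex" where "\<sigma> = (\<lambda>(s, r). of_real \<rho> + of_nat (\<upsilon> * r))"
  define c :: "nat \<times> nat \<Rightarrow> complex" where
    "c = (\<lambda>(s, r). (-1) ^ s * pochhammer (- of_nat n) (2 * s) * pochhammer (- of_nat n) (s + r)
            / (pochhammer (- of_nat n) s * fact s * fact r) * (2 * X) ^ (n - 2 * s) * w ^ (\<upsilon> * r))"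
  note HK = hermite_konhauser_conv_frac_power_sum[of B _ "of_real \<rho>" _ \<upsilon> n X w,
      folded P_def \<sigma>_def c_def]
  have \<sigma>: "Re (\<sigma> p) > -1" for p
    using assms(1) by (auto simp: \<sigma>_def split: prod.splits intro: add_strict_increasing2
        simp del: of_nat_mult)
  have f: "f t = frac_power_sum c \<sigma> P B 0 t" if "t \<ge> B" for t
    using HK[OF that, of 0] by (simp add: f_def)
  show ?thesis
    using rl_derivative_frac_power_sum[where \<mu> = \<mu>, OF assms(3) \<sigma> f] HK[of Y "- \<mu>"] assms(4) by simp
qed

end
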